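(* Let $k$ be a field of characteristic different from $2$, let $G$ be a finite abelian group with identity $e$, let $F$ be a 2-cochain on $G$ with values in $k^*$, and let $\alpha\in k^*$. For any $s:G\to k^*$ with $s(e)=1$, let $\bar G=G\times\mathbb{Z}_2$, where $\mathbb{Z}_2=\{e,\nu\}$ with $\nu^2=e$, and write $x\equiv(x,e)$ and $vx\equiv(x,\nu)$ for $x\in G$. Define $\bar F:\bar G\times\bar G\to k^*$ and $\bar s:\bar G\to k^*$ by $$\bar F(x,y)=F(x,y),\quad \bar F(x,vy)=s(x)F(x,y),\quad \bar F(vx,y)=F(y,x),\quad \bar F(vx,vy)=\alpha\, s(x)F(y,x),$$ $$\bar s(x)=s(x),\qquad \bar s(vx)=-1$$ for all $x,y\in G$. Then $\bar F$ is a 2-cochain on $\bar G$. Moreover, if the linear map $\sigma:k_FG\to k_FG$ given by $\sigma(x)=s(x)x$ for $x\in G$ is a strong involution, then $k_{\bar F}\bar G$ is the algebra obtained by applying the Cayley–Dickson process (with parameter $\alpha$) to $(k_FG,\sigma)$, with the involution of the Cayley–Dickson process being $\bar\sigma(g)=\bar s(g)g$ for $g\in\bar G$.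
   Context: A 2-cochain on a group $G$ is a map $F:G\times G\to k^*$ with $F(x,e)=F(e,x)=1$ for all $x\in G$. $k_FG$ is the $k$-vector space with basis $G$ and bilinear product $x\cdot y=F(x,y)\,xy$ for $x,y\in G$; its unit is $1=e$. A strong involution on a unital algebra $A$ is a linear map $\sigma:A\to A$ with $\sigma^2=\mathrm{id}$, $\sigma(1)=1$, $\sigma(a\cdot b)=\sigma(b)\cdot\sigma(a)$, and $a+\sigma(a),\ a\cdot\sigma(a)\in k1$ for all $a,b\in A$. The Cayley–Dickson process with parameter $\alpha$ applied to $(A,\sigma)$, with $\sigma$ a strong involution, gives the algebra $\bar A=A\oplus vA$ (a second copy of $A$ labelled by $v$) with product $(a+vb)\cdot(c+vd)=(a\cdot c+\alpha\, d\cdot\sigma(b))+v(\sigma(a)\cdot d+c\cdot b)$ and involution $\bar\sigma(a+vb)=\sigma(a)-vb$. The group element $vx\in\bar G$ corresponds to the element $vx$ of $v\,k_FG$. *)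

theory Defs
  imports "HOL-Algebra.Algebra"
begin

text \<open>
  Algebras over a field \<open>K\<close>, not assumed associative or commutative, are represented by the
  record \<^typ>\<open>('k, 'a) module\<close>, which carries a product, a unit, an addition and a scalar
  multiplication (the library locale \<open>algebra\<close> is for commutative associative algebras).
\<close>

definition linear_map ::
  "('k, 'r) ring_scheme \<Rightarrow> ('k, 'a, 'c) module_scheme \<Rightarrow> ('k, 'b, 'd) module_scheme
    \<Rightarrow> ('a \<Rightarrow> 'b) \<Rightarrow> bool" where
  "linear_map K A B f \<longleftrightarrow>
     f \<in> carrier A \<rightarrow> carrier B \<and>
     (\<forall>a\<in>carrier A. \<forall>b\<in>carrier A. f (a \<oplus>\<^bsub>A\<^esub> b) = f a \<oplus>\<^bsub>B\<^esub> f b) \<and>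
     (\<forall>c\<in>carrier K. \<forall>a\<in>carrier A. f (c \<odot>\<^bsub>A\<^esub> a) = c \<odot>\<^bsub>B\<^esub> f a)"

definition algebra_iso ::
  "('k, 'r) ring_scheme \<Rightarrow> ('k, 'a, 'c) module_scheme \<Rightarrow> ('k, 'b, 'd) module_scheme
    \<Rightarrow> ('a \<Rightarrow> 'b) \<Rightarrow> bool" where
  "algebra_iso K A B f \<longleftrightarrow>
     linear_map K A B f \<and> bij_betw f (carrier A) (carrier B) \<and>
     f \<one>\<^bsub>A\<^esub> = \<one>\<^bsub>B\<^esub> \<and>
     (\<forall>a\<in>carrier A. \<forall>b\<in>carrier A. f (a \<otimes>\<^bsub>A\<^esub> b) = f a \<otimes>\<^bsub>B\<^esub> f b)"

definition scalar_multiples_of_one ::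
  "('k, 'r) ring_scheme \<Rightarrow> ('k, 'a, 'c) module_scheme \<Rightarrow> 'a set" where
  "scalar_multiples_of_one K A = (\<lambda>c. c \<odot>\<^bsub>A\<^esub> \<one>\<^bsub>A\<^esub>) ` carrier K"

definition strong_involution ::
  "('k, 'r) ring_scheme \<Rightarrow> ('k, 'a, 'c) module_scheme \<Rightarrow> ('a \<Rightarrow> 'a) \<Rightarrow> bool" where
  "strong_involution K A \<sigma> \<longleftrightarrow>
     linear_map K A A \<sigma> \<and>
     (\<forall>a\<in>carrier A. \<sigma> (\<sigma> a) = a) \<and>
     \<sigma> \<one>\<^bsub>A\<^esub> = \<one>\<^bsub>A\<^esub> \<and>
     (\<forall>a\<in>carrier A. \<forall>b\<in>carrier A. \<sigma> (a \<otimes>\<^bsub>A\<^esub> b) = \<sigma> b \<otimes>\<^bsub>A\<^esub> \<sigma> a) \<and>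
     (\<forall>a\<in>carrier A. a \<oplus>\<^bsub>A\<^esub> \<sigma> a \<in> scalar_multiples_of_one K A) \<and>
     (\<forall>a\<in>carrier A. a \<otimes>\<^bsub>A\<^esub> \<sigma> a \<in> scalar_multiples_of_one K A)"

text \<open>The pair \<open>(a, b)\<close> stands for \<open>a + vb\<close>.\<close>

definition cayley_dickson ::
  "('k, 'a, 'c) module_scheme \<Rightarrow> ('a \<Rightarrow> 'a) \<Rightarrow> 'k \<Rightarrow> ('k, 'a \<times> 'a) module" where
  "cayley_dickson A \<sigma> \<alpha> =
     \<lparr> carrier = carrier A \<times> carrier A,
       monoid.mult = (\<lambda>(a, b) (c, d).
         (a \<otimes>\<^bsub>A\<^esub> c \<oplus>\<^bsub>A\<^esub> \<alpha> \<odot>\<^bsub>A\<^esub> (d \<otimes>\<^bsub>A\<^esub> \<sigma> b),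
          \<sigma> a \<otimes>\<^bsub>A\<^esub> d \<oplus>\<^bsub>A\<^esub> c \<otimes>\<^bsub>A\<^esub> b)),
       one = (\<one>\<^bsub>A\<^esub>, \<zero>\<^bsub>A\<^esub>),
       ring.zero = (\<zero>\<^bsub>A\<^esub>, \<zero>\<^bsub>A\<^esub>),
       ring.add = (\<lambda>(a, b) (c, d). (a \<oplus>\<^bsub>A\<^esub> c, b \<oplus>\<^bsub>A\<^esub> d)),
       smult = (\<lambda>r (a, b). (r \<odot>\<^bsub>A\<^esub> a, r \<odot>\<^bsub>A\<^esub> b)) \<rparr>"

definition cayley_dickson_involution ::
  "('k, 'a, 'c) module_scheme \<Rightarrow> ('a \<Rightarrow> 'a) \<Rightarrow> 'a \<times> 'a \<Rightarrow> 'a \<times> 'a" where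
  "cayley_dickson_involution A \<sigma> = (\<lambda>(a, b). (\<sigma> a, \<ominus>\<^bsub>A\<^esub> b))"

definition two_cochain ::
  "('k, 'r) ring_scheme \<Rightarrow> ('g, 'm) monoid_scheme \<Rightarrow> ('g \<Rightarrow> 'g \<Rightarrow> 'k) \<Rightarrow> bool" where
  "two_cochain K G F \<longleftrightarrow>
     (\<forall>x\<in>carrier G. \<forall>y\<in>carrier G. F x y \<in> Units K) \<and>
     (\<forall>x\<in>carrier G. F x \<one>\<^bsub>G\<^esub> = \<one>\<^bsub>K\<^esub> \<and> F \<one>\<^bsub>G\<^esub> x = \<one>\<^bsub>K\<^esub>)"

definition supp :: "('k, 'r) ring_scheme \<Rightarrow> ('g, 'm) monoid_scheme \<Rightarrow> ('g \<Rightarrow> 'k) \<Rightarrow> 'g set" where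
  "supp K G a = {x \<in> carrier G. a x \<noteq> \<zero>\<^bsub>K\<^esub>}"

definition basis_elem ::
  "('k, 'r) ring_scheme \<Rightarrow> ('g, 'm) monoid_scheme \<Rightarrow> 'g \<Rightarrow> 'g \<Rightarrow> 'k" where
  "basis_elem K G x = (\<lambda>z\<in>carrier G. if z = x then \<one>\<^bsub>K\<^esub> else \<zero>\<^bsub>K\<^esub>)"

text \<open>
  The vector space with basis \<open>G\<close> consists of the finitely supported coordinate functions on
  \<open>carrier G\<close>, with \<open>basis_elem K G x\<close> in the role of \<open>x\<close>. The product is the bilinear extension of
  \<open>x \<cdot> y = F(x, y) xy\<close>: the coefficient of \<open>a \<cdot> b\<close> at \<open>z\<close> collects all \<open>x, y\<close> with \<open>xy = z\<close>.
\<close>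

definition twisted_group_algebra ::
  "('k, 'r) ring_scheme \<Rightarrow> ('g, 'm) monoid_scheme \<Rightarrow> ('g \<Rightarrow> 'g \<Rightarrow> 'k) \<Rightarrow> ('k, 'g \<Rightarrow> 'k) module" where
  "twisted_group_algebra K G F =
     \<lparr> carrier = {a \<in> carrier G \<rightarrow>\<^sub>E carrier K. finite (supp K G a)},
       monoid.mult = (\<lambda>a b. \<lambda>z\<in>carrier G.
         finsum K (\<lambda>(x, y). a x \<otimes>\<^bsub>K\<^esub> b y \<otimes>\<^bsub>K\<^esub> F x y)
           {(x, y) \<in> supp K G a \<times> supp K G b. x \<otimes>\<^bsub>G\<^esub> y = z}),
       one = basis_elem K G \<one>\<^bsub>G\<^esub>,
       ring.zero = (\<lambda>z\<in>carrier G. \<zero>\<^bsub>K\<^esub>),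
       ring.add = (\<lambda>a b. \<lambda>z\<in>carrier G. a z \<oplus>\<^bsub>K\<^esub> b z),
       smult = (\<lambda>c a. \<lambda>z\<in>carrier G. c \<otimes>\<^bsub>K\<^esub> a z) \<rparr>"

text \<open>
  \<open>\<int>\<^sub>2\<close> is the library's additive group on \<open>{0, 1}\<close>, so that \<open>e = 0\<close> and \<open>\<nu> = 1\<close>; hence
  \<open>x\<close> is \<open>(x, 0)\<close> and \<open>vx\<close> is \<open>(x, 1)\<close>.
\<close>

definition bar_group :: "('g, 'm) monoid_scheme \<Rightarrow> ('g \<times> int) monoid" where
  "bar_group G = G \<times>\<times> integer_mod_group 2"

definition bar_cochain ::
  "('k, 'r) ring_scheme \<Rightarrow> ('g \<Rightarrow> 'g \<Rightarrow> 'k) \<Rightarrow> ('g \<Rightarrow> 'k) \<Rightarrow> 'k \<Rightarrow> 'g \<times> int \<Rightarrow> 'g \<times> int \<Rightarrow> 'k" where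
  "bar_cochain K F s \<alpha> = (\<lambda>(x, i) (y, j).
     if i = 0 then (if j = 0 then F x y else s x \<otimes>\<^bsub>K\<^esub> F x y)
     else (if j = 0 then F y x else \<alpha> \<otimes>\<^bsub>K\<^esub> s x \<otimes>\<^bsub>K\<^esub> F y x))"

definition bar_sign :: "('k, 'r) ring_scheme \<Rightarrow> ('g \<Rightarrow> 'k) \<Rightarrow> 'g \<times> int \<Rightarrow> 'k" where
  "bar_sign K s = (\<lambda>(x, i). if i = 0 then s x else \<ominus>\<^bsub>K\<^esub> \<one>\<^bsub>K\<^esub>)"

end

theory Submission
  imports Defs
begin

text \<open>
  A function on \<open>G \<times> \<int>\<^sub>2\<close> is the same thing as a pair of functions on \<open>G\<close>, namely its restrictions
  to the two cosets of \<open>G\<close>. This splitting (\<open>coset_components\<close>) is the isomorphism. It is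
  linear and bijective, and it sends the basis element \<open>x\<close> to \<open>x + v0\<close> and \<open>vx\<close> to \<open>0 + vx\<close>. All the
  content is in the product.

  Since \<open>\<sigma>\<close> is linear and scales each basis element \<open>x\<close> by \<open>s(x)\<close>, it multiplies the coefficient
  at \<open>x\<close> by \<open>s(x)\<close> (\<open>linear_map_diagonal_on_basis\<close>). On basis elements the Cayley-Dickson product
  then reads

  \<^item> \<open>x \<cdot> y = F(x,y) xy\<close>,
  \<^item> \<open>x \<cdot> vy = v(\<sigma>(x) \<cdot> y) = s(x) F(x,y) v(xy)\<close>,
  \<^item> \<open>vx \<cdot> y = v(y \<cdot> x) = F(y,x) v(yx)\<close>,
  \<^item> \<open>vx \<cdot> vy = \<alpha> y \<cdot> \<sigma>(x) = \<alpha> s(x) F(y,x) yx\<close>.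

  As \<open>yx = xy\<close>, these are exactly the four products that the doubled cochain prescribes. The formal
  argument compares coefficients of general elements instead of basis elements: the coefficient of
  a product at \<open>z\<close> is a sum over the factorizations \<open>z = xy\<close> (\<open>mult_twisted_group_algebra\<close>), and a
  factorization in \<open>G \<times> \<int>\<^sub>2\<close> is one in \<open>G\<close> together with the choice of the coset of its left
  factor (\<open>factorizations_bar_group\<close>). The two summands so obtained are the two summands of a
  Cayley-Dickson component; where \<open>F(y,x)\<close> occurs, commutativity of \<open>G\<close> permits exchanging the two
  factors (\<open>finsum_factorizations_swap\<close>).
\<close>

section \<open>Coordinates in a twisted group algebra\<close>
lemma carrier_twisted_group_algebra:
  assumes "finite (carrier G)"
  shows "carrier (twisted_group_algebra K G F) = carrier G \<rightarrow>\<^sub>E carrier K"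
  using assms by (auto simp: twisted_group_algebra_def supp_def)

lemma one_twisted_group_algebra [simp]:
  "\<one>\<^bsub>twisted_group_algebra K G F\<^esub> = basis_elem K G \<one>\<^bsub>G\<^esub>"
  by (simp add: twisted_group_algebra_def)

lemma zero_twisted_group_algebra:
  "\<zero>\<^bsub>twisted_group_algebra K G F\<^esub> = (\<lambda>z\<in>carrier G. \<zero>\<^bsub>K\<^esub>)"
  by (simp add: twisted_group_algebra_def)

lemma add_twisted_group_algebra:
  "a \<oplus>\<^bsub>twisted_group_algebra K G F\<^esub> b = (\<lambda>z\<in>carrier G. a z \<oplus>\<^bsub>K\<^esub> b z)"
  by (simp add: twisted_group_algebra_def)

lemma smult_twisted_group_algebra:
  "c \<odot>\<^bsub>twisted_group_algebra K G F\<^esub> a = (\<lambda>z\<in>carrier G. c \<otimes>\<^bsub>K\<^esub> a z)"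
  by (simp add: twisted_group_algebra_def)

lemmas twisted_vector_space_simps =
  zero_twisted_group_algebra add_twisted_group_algebra smult_twisted_group_algebra

lemma basis_elem_in_carrier:
  assumes "cring K" "finite (carrier G)"
  shows "basis_elem K G x \<in> carrier (twisted_group_algebra K G F)"
proof -
  interpret cring K by fact
  show ?thesis
    using assms(2) by (auto simp: carrier_twisted_group_algebra basis_elem_def)
qed

text \<open>
  The second component of the Cayley-Dickson involution is the additive inverse in the algebra. The
  group axioms are what pins that inverse down as the pointwise one.
\<close>
lemma abelian_group_twisted_group_algebra:
  assumes "cring K" "finite (carrier G)"
  shows "abelian_group (twisted_group_algebra K G F)"
proof -
  interpret cring K by fact
  show ?thesis
  proof (rule abelian_groupI)
    fix a assume a: "a \<in> carrier (twisted_group_algebra K G F)"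
    then have "(\<lambda>z\<in>carrier G. \<ominus>\<^bsub>K\<^esub> a z) \<in> carrier (twisted_group_algebra K G F)"
      by (auto simp: carrier_twisted_group_algebra[OF assms(2)])
    moreover have "(\<lambda>z\<in>carrier G. \<ominus>\<^bsub>K\<^esub> a z) \<oplus>\<^bsub>twisted_group_algebra K G F\<^esub> a
        = \<zero>\<^bsub>twisted_group_algebra K G F\<^esub>"
      using a by (auto simp: carrier_twisted_group_algebra[OF assms(2)]
          twisted_vector_space_simps fun_eq_iff PiE_iff l_neg)
    ultimately show "\<exists>y\<in>carrier (twisted_group_algebra K G F).
        y \<oplus>\<^bsub>twisted_group_algebra K G F\<^esub> a = \<zero>\<^bsub>twisted_group_algebra K G F\<^esub>" by blast
  qed (auto simp: carrier_twisted_group_algebra[OF assms(2)] twisted_vector_space_simps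
      fun_eq_iff PiE_iff a_assoc extensional_def intro!: a_comm)
qed

lemma a_inv_twisted_group_algebra:
  assumes "cring K" "finite (carrier G)" "a \<in> carrier (twisted_group_algebra K G F)"
  shows "\<ominus>\<^bsub>twisted_group_algebra K G F\<^esub> a = (\<lambda>z\<in>carrier G. \<ominus>\<^bsub>K\<^esub> a z)"
proof -
  interpret cring K by fact
  interpret A: abelian_group "twisted_group_algebra K G F"
    using assms(1,2) by (rule abelian_group_twisted_group_algebra)
  show ?thesis
  proof (rule A.minus_equality)
    show "(\<lambda>z\<in>carrier G. \<ominus>\<^bsub>K\<^esub> a z) \<oplus>\<^bsub>twisted_group_algebra K G F\<^esub> a
        = \<zero>\<^bsub>twisted_group_algebra K G F\<^esub>"
      using assms(3) by (auto simp: carrier_twisted_group_algebra[OF assms(2)]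
          twisted_vector_space_simps fun_eq_iff PiE_iff l_neg)
  qed (use assms(2,3) in \<open>auto simp: carrier_twisted_group_algebra\<close>)
qed

lemma linear_map_zero:
  assumes "abelian_group A" "abelian_group B" "linear_map K A B f"
  shows "f \<zero>\<^bsub>A\<^esub> = \<zero>\<^bsub>B\<^esub>"
proof -
  interpret A: abelian_group A by fact
  interpret B: abelian_group B by fact
  have f0: "f \<zero>\<^bsub>A\<^esub> \<in> carrier B"
    using assms(3) by (auto simp: linear_map_def)
  have "f (\<zero>\<^bsub>A\<^esub> \<oplus>\<^bsub>A\<^esub> \<zero>\<^bsub>A\<^esub>) = f \<zero>\<^bsub>A\<^esub> \<oplus>\<^bsub>B\<^esub> f \<zero>\<^bsub>A\<^esub>"
    using assms(3) unfolding linear_map_def by blast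
  then have "f \<zero>\<^bsub>A\<^esub> \<oplus>\<^bsub>B\<^esub> f \<zero>\<^bsub>A\<^esub> = f \<zero>\<^bsub>A\<^esub>"
    by simp
  then show ?thesis
    using f0 by (metis B.add.r_cancel_one)
qed

text \<open>
  By induction on a set that contains the support of \<open>a\<close>: splitting off the term \<open>a(x) x\<close> removes
  \<open>x\<close> from the support.
\<close>
lemma linear_map_eq_on_basis:
  assumes "cring K" "finite (carrier G)" "abelian_group B"
    and f: "linear_map K (twisted_group_algebra K G F) B f"
    and g: "linear_map K (twisted_group_algebra K G F) B g"
    and basis: "\<And>x. x \<in> carrier G \<Longrightarrow> f (basis_elem K G x) = g (basis_elem K G x)"
    and a: "a \<in> carrier (twisted_group_algebra K G F)"
  shows "f a = g a"
proof -
  let ?A = "twisted_group_algebra K G F"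
  interpret cring K by fact
  have A: "abelian_group ?A"
    using assms(1,2) by (rule abelian_group_twisted_group_algebra)
  note carr = carrier_twisted_group_algebra[OF assms(2)]
  have "f a = g a" if "finite S" "S \<subseteq> carrier G" "a \<in> carrier ?A" "supp K G a \<subseteq> S" for S a
    using that
  proof (induction S arbitrary: a rule: finite_induct)
    case empty
    then have "a = \<zero>\<^bsub>?A\<^esub>"
      by (auto simp: supp_def carr zero_twisted_group_algebra PiE_iff extensional_def fun_eq_iff)
    then show ?case
      using linear_map_zero[OF A assms(3) f] linear_map_zero[OF A assms(3) g] by simp
  next
    case (insert x S)
    define b where "b = a(x := \<zero>\<^bsub>K\<^esub>)"
    have x: "x \<in> carrier G" and aK: "\<And>z. z \<in> carrier G \<Longrightarrow> a z \<in> carrier K"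
      using insert.prems by (auto simp: carr)
    have b: "b \<in> carrier ?A"
      using insert.prems by (auto simp: carr b_def PiE_iff extensional_def)
    have fgb: "f b = g b"
    proof (rule insert.IH[OF _ b])
      show "supp K G b \<subseteq> S"
        using insert.prems by (auto simp: supp_def b_def)
    qed (use insert.prems in auto)
    have e: "basis_elem K G x \<in> carrier ?A"
      using assms(1,2) by (rule basis_elem_in_carrier)
    have xe: "a x \<odot>\<^bsub>?A\<^esub> basis_elem K G x \<in> carrier ?A"
      using e aK[OF x] by (auto simp: carr smult_twisted_group_algebra)
    have decomp: "a = b \<oplus>\<^bsub>?A\<^esub> (a x \<odot>\<^bsub>?A\<^esub> basis_elem K G x)"
      using insert.prems aK x
      by (auto simp: carr b_def twisted_vector_space_simps basis_elem_def fun_eq_iff PiE_iff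
          extensional_def)
    have split: "h a = h b \<oplus>\<^bsub>B\<^esub> (a x \<odot>\<^bsub>B\<^esub> h (basis_elem K G x))"
      if "linear_map K ?A B h" for h
      using that b e xe aK[OF x] by (subst decomp) (simp add: linear_map_def)
    show ?case
      using split[OF f] split[OF g] fgb basis[OF x] by simp
  qed
  from this[of "carrier G" a] show ?thesis
    using assms(2) a by (auto simp: supp_def)
qed

lemma linear_map_scaling_coordinates:
  assumes "cring K" "finite (carrier G)" "s \<in> carrier G \<rightarrow> carrier K"
  shows "linear_map K (twisted_group_algebra K G F) (twisted_group_algebra K G F)
           (\<lambda>a. \<lambda>x\<in>carrier G. s x \<otimes>\<^bsub>K\<^esub> a x)"
proof -
  interpret cring K by fact
  show ?thesis
    using assms(3)
    by (auto simp: linear_map_def carrier_twisted_group_algebra[OF assms(2)] Pi_iff PiE_iff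
        twisted_vector_space_simps fun_eq_iff r_distr m_lcomm)
qed

text \<open>
  Pointwise multiplication by \<open>s\<close> is linear and also scales each basis element \<open>x\<close> by \<open>s(x)\<close>, so
  \<open>\<sigma>\<close> coincides with it. In this form \<open>\<sigma>\<close> can be substituted into sums of coefficients.
\<close>
lemma linear_map_diagonal_on_basis:
  assumes "cring K" "finite (carrier G)" "s \<in> carrier G \<rightarrow> carrier K"
    and \<sigma>: "linear_map K (twisted_group_algebra K G F) (twisted_group_algebra K G F) \<sigma>"
    and basis: "\<And>x. x \<in> carrier G \<Longrightarrow>
      \<sigma> (basis_elem K G x) = s x \<odot>\<^bsub>twisted_group_algebra K G F\<^esub> basis_elem K G x"
    and a: "a \<in> carrier (twisted_group_algebra K G F)"
  shows "\<sigma> a = (\<lambda>x\<in>carrier G. s x \<otimes>\<^bsub>K\<^esub> a x)"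
proof (rule linear_map_eq_on_basis[OF assms(1,2) _ \<sigma> linear_map_scaling_coordinates _ a])
  interpret cring K by fact
  show "\<sigma> (basis_elem K G x) = (\<lambda>y\<in>carrier G. s y \<otimes>\<^bsub>K\<^esub> basis_elem K G x y)"
    if "x \<in> carrier G" for x
    unfolding basis[OF that] using assms(3) that
    by (auto simp: smult_twisted_group_algebra basis_elem_def fun_eq_iff Pi_iff)
qed (use assms abelian_group_twisted_group_algebra in auto)

section \<open>Products as sums over factorizations\<close>

definition factorizations :: "('g, 'm) monoid_scheme \<Rightarrow> 'g \<Rightarrow> ('g \<times> 'g) set" where
  "factorizations G z = {(x, y) \<in> carrier G \<times> carrier G. x \<otimes>\<^bsub>G\<^esub> y = z}"

lemma finite_factorizations [simp]:
  "finite (carrier G) \<Longrightarrow> finite (factorizations G z)"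
  by (rule finite_subset[of _ "carrier G \<times> carrier G"]) (auto simp: factorizations_def)

text \<open>
  Summing over all factorizations rather than over those inside the supports adds only zero terms,
  and makes the index set independent of \<open>a\<close> and \<open>b\<close>, so that sums for different pairs of elements
  can be compared term by term.
\<close>
lemma mult_twisted_group_algebra:
  assumes "cring K" "finite (carrier G)"
    and F: "F \<in> carrier G \<rightarrow> carrier G \<rightarrow> carrier K"
    and a: "a \<in> carrier (twisted_group_algebra K G F)"
    and b: "b \<in> carrier (twisted_group_algebra K G F)"
    and z: "z \<in> carrier G"
  shows "(a \<otimes>\<^bsub>twisted_group_algebra K G F\<^esub> b) z
    = finsum K (\<lambda>(x, y). a x \<otimes>\<^bsub>K\<^esub> b y \<otimes>\<^bsub>K\<^esub> F x y) (factorizations G z)"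
proof -
  interpret cring K by fact
  have ab: "a x \<in> carrier K" "b x \<in> carrier K" if "x \<in> carrier G" for x
    using a b that by (auto simp: carrier_twisted_group_algebra[OF assms(2)])
  have "finsum K (\<lambda>(x, y). a x \<otimes>\<^bsub>K\<^esub> b y \<otimes>\<^bsub>K\<^esub> F x y)
           {(x, y) \<in> supp K G a \<times> supp K G b. x \<otimes>\<^bsub>G\<^esub> y = z}
      = finsum K (\<lambda>(x, y). a x \<otimes>\<^bsub>K\<^esub> b y \<otimes>\<^bsub>K\<^esub> F x y) (factorizations G z)"
  proof (rule add.finprod_mono_neutral_cong_left)
    show "finite (factorizations G z)"
      using assms(2) by simp
  qed (use ab F in \<open>auto simp: factorizations_def supp_def Pi_iff\<close>)
  then show ?thesis
    using z by (simp add: twisted_group_algebra_def)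
qed

lemma finsum_factorizations_swap:
  assumes "comm_group G" "abelian_monoid K"
    and "\<And>x y. x \<in> carrier G \<Longrightarrow> y \<in> carrier G \<Longrightarrow> h x y \<in> carrier K"
  shows "finsum K (\<lambda>(x, y). h x y) (factorizations G z)
    = finsum K (\<lambda>(x, y). h y x) (factorizations G z)"
proof -
  interpret G: comm_group G by fact
  interpret K: abelian_monoid K by fact
  have swap: "prod.swap ` factorizations G z = factorizations G z"
    by (auto simp: factorizations_def G.m_comm image_iff)
  have "finsum K (\<lambda>(x, y). h x y) (prod.swap ` factorizations G z)
      = finsum K (\<lambda>p. (\<lambda>(x, y). h x y) (prod.swap p)) (factorizations G z)"
    by (rule K.finsum_reindex)
      (use assms(3) in \<open>auto simp: factorizations_def intro: inj_on_subset[OF inj_swap]\<close>)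
  also have "\<dots> = finsum K (\<lambda>(x, y). h y x) (factorizations G z)"
    by (simp add: case_prod_unfold)
  finally show ?thesis
    unfolding swap .
qed

section \<open>The doubled group\<close>
lemma carrier_bar_group: "carrier (bar_group G) = carrier G \<times> {0, 1}"
  by (auto simp: bar_group_def carrier_integer_mod_group)

lemma one_bar_group [simp]: "\<one>\<^bsub>bar_group G\<^esub> = (\<one>\<^bsub>G\<^esub>, 0)"
  by (simp add: bar_group_def)

lemma mult_bar_group [simp]:
  "(x, i) \<otimes>\<^bsub>bar_group G\<^esub> (y, j) = (x \<otimes>\<^bsub>G\<^esub> y, (i + j) mod 2)"
  by (simp add: bar_group_def)

lemma two_cochain_bar_cochain:
  assumes "cring K" "two_cochain K G F" "\<alpha> \<in> Units K"
    and "s \<in> carrier G \<rightarrow> Units K" "s \<one>\<^bsub>G\<^esub> = \<one>\<^bsub>K\<^esub>" "monoid G"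
  shows "two_cochain K (bar_group G) (bar_cochain K F s \<alpha>)"
proof -
  interpret cring K by fact
  interpret G: monoid G by fact
  show ?thesis
    using assms(2-5)
    by (auto simp: two_cochain_def bar_cochain_def carrier_bar_group Pi_iff)
qed

text \<open>
  The left factor of \<open>(w, k)\<close> may lie in either coset, and the coset of the right factor is then
  determined. For \<open>k \<in> {0, 1}\<close> it is \<open>k\<close> or \<open>1 - k\<close>, which avoids reduction modulo 2.
\<close>
lemma factorizations_bar_group:
  assumes "k \<in> {0, 1}"
  shows "factorizations (bar_group G) (w, k)
    = (\<lambda>(x, y). ((x, 0), (y, k))) ` factorizations G w
      \<union> (\<lambda>(x, y). ((x, 1), (y, 1 - k))) ` factorizations G w"
  using assms by (auto simp: factorizations_def carrier_bar_group image_iff)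

text \<open>
  The two sums are what is matched with the two summands of a Cayley-Dickson component: \<open>k = 0\<close>
  gives the first component of the product and \<open>k = 1\<close> the second.
\<close>
lemma mult_twisted_bar_group:
  fixes G :: "('g, 'm) monoid_scheme"
  assumes "cring K" "finite (carrier G)"
    and F: "F \<in> carrier (bar_group G) \<rightarrow> carrier (bar_group G) \<rightarrow> carrier K"
    and a: "a \<in> carrier (twisted_group_algebra K (bar_group G) F)"
    and b: "b \<in> carrier (twisted_group_algebra K (bar_group G) F)"
    and w: "w \<in> carrier G" and k: "k \<in> {0, 1}"
  shows "(a \<otimes>\<^bsub>twisted_group_algebra K (bar_group G) F\<^esub> b) (w, k)
    = finsum K (\<lambda>(x, y). a (x, 0) \<otimes>\<^bsub>K\<^esub> b (y, k) \<otimes>\<^bsub>K\<^esub> F (x, 0) (y, k)) (factorizations G w)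
      \<oplus>\<^bsub>K\<^esub> finsum K (\<lambda>(x, y). a (x, 1) \<otimes>\<^bsub>K\<^esub> b (y, 1 - k) \<otimes>\<^bsub>K\<^esub> F (x, 1) (y, 1 - k))
          (factorizations G w)"
proof -
  interpret cring K by fact
  have fin: "finite (carrier (bar_group G))"
    using assms(2) by (simp add: carrier_bar_group)
  have ab: "a p \<in> carrier K" "b p \<in> carrier K" if "p \<in> carrier (bar_group G)" for p
    using a b that by (auto simp: carrier_twisted_group_algebra[OF fin])
  define h where "h = (\<lambda>(p, q). a p \<otimes>\<^bsub>K\<^esub> b q \<otimes>\<^bsub>K\<^esub> F p q)"
  define \<iota> where "\<iota> = (\<lambda>i j (x :: 'g, y :: 'g). ((x, i :: int), (y, j :: int)))"
  have h: "h \<circ> \<iota> i j \<in> factorizations G w \<rightarrow> carrier K" if "i \<in> {0, 1}" "j \<in> {0, 1}" for i j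
    using that ab F
    by (auto simp: h_def \<iota>_def factorizations_def carrier_bar_group Pi_iff)
  have k': "1 - k \<in> {0, 1}"
    using k by auto
  have reindex: "finsum K h (\<iota> i j ` factorizations G w)
      = finsum K (\<lambda>(x, y). a (x, i) \<otimes>\<^bsub>K\<^esub> b (y, j) \<otimes>\<^bsub>K\<^esub> F (x, i) (y, j)) (factorizations G w)"
    if ij: "i \<in> {0, 1}" "j \<in> {0, 1}" for i j
  proof -
    have "finsum K h (\<iota> i j ` factorizations G w)
        = finsum K (\<lambda>p. h (\<iota> i j p)) (factorizations G w)"
      by (rule finsum_reindex) (use h[OF ij] in \<open>auto simp: \<iota>_def inj_on_def Pi_iff\<close>)
    then show ?thesis
      by (simp add: h_def \<iota>_def case_prod_unfold)
  qed
  have "(a \<otimes>\<^bsub>twisted_group_algebra K (bar_group G) F\<^esub> b) (w, k)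
      = finsum K h (factorizations (bar_group G) (w, k))"
    unfolding h_def
    by (rule mult_twisted_group_algebra[OF assms(1) fin F a b])
      (use w k in \<open>auto simp: carrier_bar_group\<close>)
  also have "factorizations (bar_group G) (w, k)
      = \<iota> 0 k ` factorizations G w \<union> \<iota> 1 (1 - k) ` factorizations G w"
    unfolding \<iota>_def by (rule factorizations_bar_group[OF k])
  also have "finsum K h \<dots> = finsum K h (\<iota> 0 k ` factorizations G w)
      \<oplus>\<^bsub>K\<^esub> finsum K h (\<iota> 1 (1 - k) ` factorizations G w)"
  proof (rule finsum_Un_disjoint)
    show "h \<in> \<iota> 0 k ` factorizations G w \<rightarrow> carrier K"
      using h[of 0 k] k by (auto simp: Pi_iff)
    show "h \<in> \<iota> 1 (1 - k) ` factorizations G w \<rightarrow> carrier K"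
      using h[of 1 "1 - k"] k' by (auto simp: Pi_iff)
    show "\<iota> 0 k ` factorizations G w \<inter> \<iota> 1 (1 - k) ` factorizations G w = {}"
      by (auto simp: \<iota>_def)
  qed (simp_all add: assms(2))
  finally show ?thesis
    unfolding reindex[OF insertI1 k] reindex[OF insertI2[OF singletonI] k'] .
qed

section \<open>Splitting along the two cosets\<close>

definition coset_components ::
  "('g, 'm) monoid_scheme \<Rightarrow> ('g \<times> int \<Rightarrow> 'k) \<Rightarrow> ('g \<Rightarrow> 'k) \<times> ('g \<Rightarrow> 'k)" where
  "coset_components G a = ((\<lambda>x\<in>carrier G. a (x, 0)), (\<lambda>x\<in>carrier G. a (x, 1)))"

lemma bij_betw_coset_components:
  assumes "finite (carrier G)"
  shows "bij_betw (coset_components G)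
    (carrier (twisted_group_algebra K (bar_group G) F'))
    (carrier (cayley_dickson (twisted_group_algebra K G F) \<sigma> \<alpha>))"
proof (rule bij_betw_byWitness)
  let ?glue = "\<lambda>(a, b). \<lambda>(x, i)\<in>carrier (bar_group G). if i = 0 then a x else b x"
  have fin: "finite (carrier (bar_group G))"
    using assms by (simp add: carrier_bar_group)
  note carr = carrier_twisted_group_algebra[OF assms] carrier_twisted_group_algebra[OF fin]
  show "\<forall>a\<in>carrier (twisted_group_algebra K (bar_group G) F'). ?glue (coset_components G a) = a"
    by (auto simp: carr carrier_bar_group coset_components_def fun_eq_iff PiE_iff extensional_def)
  show "\<forall>p\<in>carrier (cayley_dickson (twisted_group_algebra K G F) \<sigma> \<alpha>).
      coset_components G (?glue p) = p"
    by (auto simp: cayley_dickson_def carr carrier_bar_group coset_components_def fun_eq_iff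
        PiE_iff extensional_def)
  show "coset_components G ` carrier (twisted_group_algebra K (bar_group G) F')
      \<subseteq> carrier (cayley_dickson (twisted_group_algebra K G F) \<sigma> \<alpha>)"
    by (auto simp: cayley_dickson_def carr carrier_bar_group coset_components_def)
  show "?glue ` carrier (cayley_dickson (twisted_group_algebra K G F) \<sigma> \<alpha>)
      \<subseteq> carrier (twisted_group_algebra K (bar_group G) F')"
    by (auto simp: cayley_dickson_def carr carrier_bar_group PiE_iff extensional_def split: if_splits)
qed

lemma linear_map_coset_components:
  assumes "finite (carrier G)"
  shows "linear_map K (twisted_group_algebra K (bar_group G) F')
    (cayley_dickson (twisted_group_algebra K G F) \<sigma> \<alpha>) (coset_components G)"
  using bij_betw_imp_funcset[OF bij_betw_coset_components[OF assms]]
  by (auto simp: linear_map_def cayley_dickson_def coset_components_def carrier_bar_group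
      twisted_vector_space_simps)

lemma coset_components_basis_elem:
  "coset_components G (basis_elem K (bar_group G) (x, 0))
     = (basis_elem K G x, \<zero>\<^bsub>twisted_group_algebra K G F\<^esub>)"
  "coset_components G (basis_elem K (bar_group G) (x, 1))
     = (\<zero>\<^bsub>twisted_group_algebra K G F\<^esub>, basis_elem K G x)"
  by (auto simp: coset_components_def basis_elem_def carrier_bar_group
      zero_twisted_group_algebra fun_eq_iff)

text \<open>
  The four ways to choose the cosets of the two factors give the four products in the
  Cayley-Dickson formula. Each of the facts \<open>00\<close>, \<open>01\<close>, \<open>10\<close>, \<open>11\<close> in the proof treats one choice,
  named by the cosets of the left and of the right factor. If the left factor lies in \<open>vG\<close>, the
  formula multiplies in the opposite order, and the sum is reindexed by exchanging the factors.
\<close>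
lemma coset_components_mult:
  assumes "cring K" "comm_group G" "finite (carrier G)"
    and F: "F \<in> carrier G \<rightarrow> carrier G \<rightarrow> carrier K"
    and \<alpha>: "\<alpha> \<in> carrier K" and s: "s \<in> carrier G \<rightarrow> carrier K"
    and \<sigma>: "\<forall>a\<in>carrier (twisted_group_algebra K G F). \<sigma> a = (\<lambda>x\<in>carrier G. s x \<otimes>\<^bsub>K\<^esub> a x)"
    and a: "a \<in> carrier (twisted_group_algebra K (bar_group G) (bar_cochain K F s \<alpha>))"
    and b: "b \<in> carrier (twisted_group_algebra K (bar_group G) (bar_cochain K F s \<alpha>))"
  shows "coset_components G
      (a \<otimes>\<^bsub>twisted_group_algebra K (bar_group G) (bar_cochain K F s \<alpha>)\<^esub> b)
    = coset_components G a
      \<otimes>\<^bsub>cayley_dickson (twisted_group_algebra K G F) \<sigma> \<alpha>\<^esub> coset_components G b"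
proof -
  let ?A = "twisted_group_algebra K G F"
  let ?B = "twisted_group_algebra K (bar_group G) (bar_cochain K F s \<alpha>)"
  interpret cring K by fact
  have Fxy: "F x y \<in> carrier K" if "x \<in> carrier G" "y \<in> carrier G" for x y
    using F that by auto
  have F': "bar_cochain K F s \<alpha> \<in> carrier (bar_group G) \<rightarrow> carrier (bar_group G) \<rightarrow> carrier K"
    using Fxy \<alpha> s by (auto simp: bar_cochain_def carrier_bar_group Pi_iff)
  obtain a0 a1 where a01: "coset_components G a = (a0, a1)" by force
  obtain b0 b1 where b01: "coset_components G b = (b0, b1)" by force
  have in_A: "a0 \<in> carrier ?A" "a1 \<in> carrier ?A" "b0 \<in> carrier ?A" "b1 \<in> carrier ?A"
    using bij_betw_imp_funcset[OF bij_betw_coset_components[OF assms(3)]] a b a01 b01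
    by (force simp: cayley_dickson_def)+
  have val: "a (x, 0) = a0 x" "a (x, 1) = a1 x" "b (x, 0) = b0 x" "b (x, 1) = b1 x"
    if "x \<in> carrier G" for x
    using that a01 b01 by (auto simp: coset_components_def)
  have K: "a0 x \<in> carrier K" "a1 x \<in> carrier K" "b0 x \<in> carrier K" "b1 x \<in> carrier K"
    "s x \<in> carrier K" if "x \<in> carrier G" for x
    using that in_A s by (auto simp: carrier_twisted_group_algebra[OF assms(3)])
  have \<sigma>A: "\<sigma> c \<in> carrier ?A" if "c \<in> carrier ?A" for c
    using that s by (auto simp: \<sigma> carrier_twisted_group_algebra[OF assms(3)])
  note multA = mult_twisted_group_algebra[OF assms(1,3) F]
  note multB = mult_twisted_bar_group[OF assms(1,3) F' a b]
  have cong: "finsum K (\<lambda>(x, y). f x y) (factorizations G w)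
      = finsum K (\<lambda>(x, y). g x y) (factorizations G w)"
    if "\<And>x y. x \<in> carrier G \<Longrightarrow> y \<in> carrier G \<Longrightarrow> f x y = g x y"
      and "\<And>x y. x \<in> carrier G \<Longrightarrow> y \<in> carrier G \<Longrightarrow> g x y \<in> carrier K" for f g w
    by (rule finsum_cong') (use that in \<open>auto simp: factorizations_def\<close>)
  have swap: "finsum K (\<lambda>(x, y). h x y) (factorizations G w)
      = finsum K (\<lambda>(x, y). h y x) (factorizations G w)"
    if "\<And>x y. x \<in> carrier G \<Longrightarrow> y \<in> carrier G \<Longrightarrow> h x y \<in> carrier K" for h w
    using assms(2) abelian_monoid_axioms that by (rule finsum_factorizations_swap)

  have 00: "finsum K (\<lambda>(x, y). a (x, 0) \<otimes>\<^bsub>K\<^esub> b (y, 0) \<otimes>\<^bsub>K\<^esub> bar_cochain K F s \<alpha> (x, 0) (y, 0))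
      (factorizations G w) = (a0 \<otimes>\<^bsub>?A\<^esub> b0) w" if w: "w \<in> carrier G" for w
    unfolding multA[OF in_A(1,3) w]
    by (rule cong) (simp_all add: val bar_cochain_def K Fxy)
  have 01: "finsum K (\<lambda>(x, y). a (x, 0) \<otimes>\<^bsub>K\<^esub> b (y, 1) \<otimes>\<^bsub>K\<^esub> bar_cochain K F s \<alpha> (x, 0) (y, 1))
      (factorizations G w) = (\<sigma> a0 \<otimes>\<^bsub>?A\<^esub> b1) w" if w: "w \<in> carrier G" for w
    unfolding multA[OF \<sigma>A[OF in_A(1)] in_A(4) w]
    by (rule cong) (simp_all add: val bar_cochain_def \<sigma> in_A K Fxy m_ac)
  have 10: "finsum K (\<lambda>(x, y). a (x, 1) \<otimes>\<^bsub>K\<^esub> b (y, 0) \<otimes>\<^bsub>K\<^esub> bar_cochain K F s \<alpha> (x, 1) (y, 0))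
      (factorizations G w) = (b0 \<otimes>\<^bsub>?A\<^esub> a1) w" if w: "w \<in> carrier G" for w
  proof -
    have "(b0 \<otimes>\<^bsub>?A\<^esub> a1) w
        = finsum K (\<lambda>(x, y). b0 y \<otimes>\<^bsub>K\<^esub> a1 x \<otimes>\<^bsub>K\<^esub> F y x) (factorizations G w)"
      unfolding multA[OF in_A(3,2) w] by (rule swap) (simp add: K Fxy)
    also have "\<dots> = finsum K
        (\<lambda>(x, y). a (x, 1) \<otimes>\<^bsub>K\<^esub> b (y, 0) \<otimes>\<^bsub>K\<^esub> bar_cochain K F s \<alpha> (x, 1) (y, 0))
        (factorizations G w)"
      by (rule cong) (simp_all add: val bar_cochain_def K Fxy m_ac)
    finally show ?thesis by simp
  qed
  have 11: "finsum K (\<lambda>(x, y). a (x, 1) \<otimes>\<^bsub>K\<^esub> b (y, 1) \<otimes>\<^bsub>K\<^esub> bar_cochain K F s \<alpha> (x, 1) (y, 1))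
      (factorizations G w) = \<alpha> \<otimes>\<^bsub>K\<^esub> (b1 \<otimes>\<^bsub>?A\<^esub> \<sigma> a1) w" if w: "w \<in> carrier G" for w
  proof -
    have "(b1 \<otimes>\<^bsub>?A\<^esub> \<sigma> a1) w
        = finsum K (\<lambda>(x, y). b1 y \<otimes>\<^bsub>K\<^esub> \<sigma> a1 x \<otimes>\<^bsub>K\<^esub> F y x) (factorizations G w)"
      unfolding multA[OF in_A(4) \<sigma>A[OF in_A(2)] w]
      by (rule swap) (simp add: \<sigma> in_A K Fxy)
    then have "\<alpha> \<otimes>\<^bsub>K\<^esub> (b1 \<otimes>\<^bsub>?A\<^esub> \<sigma> a1) w
        = finsum K (\<lambda>p. \<alpha> \<otimes>\<^bsub>K\<^esub> (case p of (x, y) \<Rightarrow> b1 y \<otimes>\<^bsub>K\<^esub> \<sigma> a1 x \<otimes>\<^bsub>K\<^esub> F y x))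
            (factorizations G w)"
      by (simp only:, intro finsum_rdistr finite_factorizations assms(3) \<alpha>)
        (auto simp: factorizations_def \<sigma> in_A K Fxy)
    also have "\<dots> = finsum K (\<lambda>(x, y). \<alpha> \<otimes>\<^bsub>K\<^esub> (b1 y \<otimes>\<^bsub>K\<^esub> \<sigma> a1 x \<otimes>\<^bsub>K\<^esub> F y x))
            (factorizations G w)"
      by (simp add: case_prod_unfold)
    also have "\<dots> = finsum K
        (\<lambda>(x, y). a (x, 1) \<otimes>\<^bsub>K\<^esub> b (y, 1) \<otimes>\<^bsub>K\<^esub> bar_cochain K F s \<alpha> (x, 1) (y, 1))
        (factorizations G w)"
      by (rule cong) (simp_all add: val bar_cochain_def \<sigma> in_A \<alpha> K Fxy m_ac)
    finally show ?thesis by simp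
  qed

  have "coset_components G (a \<otimes>\<^bsub>?B\<^esub> b)
      = (\<lambda>w\<in>carrier G. (a0 \<otimes>\<^bsub>?A\<^esub> b0) w \<oplus>\<^bsub>K\<^esub> \<alpha> \<otimes>\<^bsub>K\<^esub> (b1 \<otimes>\<^bsub>?A\<^esub> \<sigma> a1) w,
         \<lambda>w\<in>carrier G. (\<sigma> a0 \<otimes>\<^bsub>?A\<^esub> b1) w \<oplus>\<^bsub>K\<^esub> (b0 \<otimes>\<^bsub>?A\<^esub> a1) w)"
    unfolding coset_components_def prod.inject
    by (intro conjI restrict_ext) (simp_all add: multB 00 01 10 11 del: One_nat_def)
  then show ?thesis
    by (auto simp: a01 b01 cayley_dickson_def twisted_vector_space_simps fun_eq_iff)
qed

lemma coset_components_algebra_iso: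
  assumes "cring K" "comm_group G" "finite (carrier G)"
    and "F \<in> carrier G \<rightarrow> carrier G \<rightarrow> carrier K"
    and "\<alpha> \<in> carrier K" and "s \<in> carrier G \<rightarrow> carrier K"
    and "\<forall>a\<in>carrier (twisted_group_algebra K G F). \<sigma> a = (\<lambda>x\<in>carrier G. s x \<otimes>\<^bsub>K\<^esub> a x)"
  shows "algebra_iso K (twisted_group_algebra K (bar_group G) (bar_cochain K F s \<alpha>))
    (cayley_dickson (twisted_group_algebra K G F) \<sigma> \<alpha>) (coset_components G)"
proof -
  have "coset_components G \<one>\<^bsub>twisted_group_algebra K (bar_group G) (bar_cochain K F s \<alpha>)\<^esub>
      = \<one>\<^bsub>cayley_dickson (twisted_group_algebra K G F) \<sigma> \<alpha>\<^esub>"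
    by (simp add: coset_components_basis_elem(1)[of G K _ F] cayley_dickson_def)
  then show ?thesis
    unfolding algebra_iso_def
    by (intro conjI ballI linear_map_coset_components[OF assms(3)]
        bij_betw_coset_components[OF assms(3)] coset_components_mult[OF assms])
qed

text \<open>
  On \<open>x\<close> the Cayley-Dickson involution acts as \<open>\<sigma>\<close>, hence by \<open>s(x)\<close>; on \<open>vx\<close> it negates the second
  component, hence acts by \<open>-1\<close>. The zero in the other component is fixed in both cases.
\<close>
lemma cayley_dickson_involution_coset_components:
  assumes "cring K" "finite (carrier G)"
    and s: "s \<in> carrier G \<rightarrow> carrier K"
    and \<sigma>: "\<forall>a\<in>carrier (twisted_group_algebra K G F). \<sigma> a = (\<lambda>x\<in>carrier G. s x \<otimes>\<^bsub>K\<^esub> a x)"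
    and g: "g \<in> carrier (bar_group G)"
  shows "cayley_dickson_involution (twisted_group_algebra K G F) \<sigma>
      (coset_components G (basis_elem K (bar_group G) g))
    = coset_components G (bar_sign K s g
        \<odot>\<^bsub>twisted_group_algebra K (bar_group G) F'\<^esub> basis_elem K (bar_group G) g)"
proof -
  let ?A = "twisted_group_algebra K G F"
  interpret cring K by fact
  interpret A: abelian_group ?A
    using assms(1,2) by (rule abelian_group_twisted_group_algebra)
  have e: "basis_elem K G x \<in> carrier ?A" for x
    using assms(1,2) by (rule basis_elem_in_carrier)
  have sK: "s x \<in> carrier K" if "x \<in> carrier G" for x
    using s that by auto
  have \<sigma>e: "\<sigma> (basis_elem K G x) = s x \<odot>\<^bsub>?A\<^esub> basis_elem K G x" if "x \<in> carrier G" for x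
    unfolding \<sigma>[rule_format, OF e] using sK that by (auto simp: smult_twisted_group_algebra basis_elem_def fun_eq_iff)
  have \<sigma>0: "\<sigma> \<zero>\<^bsub>?A\<^esub> = \<zero>\<^bsub>?A\<^esub>"
    unfolding \<sigma>[rule_format, OF A.zero_closed] using sK by (auto simp: zero_twisted_group_algebra fun_eq_iff)
  have neg: "\<ominus>\<^bsub>?A\<^esub> basis_elem K G x = (\<ominus>\<^bsub>K\<^esub> \<one>\<^bsub>K\<^esub>) \<odot>\<^bsub>?A\<^esub> basis_elem K G x" for x
    unfolding a_inv_twisted_group_algebra[OF assms(1,2) e] by (auto simp: smult_twisted_group_algebra
        basis_elem_def fun_eq_iff)
  have smult: "coset_components G (c \<odot>\<^bsub>twisted_group_algebra K (bar_group G) F'\<^esub> a)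
      = (c \<odot>\<^bsub>?A\<^esub> fst (coset_components G a), c \<odot>\<^bsub>?A\<^esub> snd (coset_components G a))" for c a
    by (simp add: coset_components_def smult_twisted_group_algebra carrier_bar_group fun_eq_iff)
  have smult0: "c \<odot>\<^bsub>?A\<^esub> \<zero>\<^bsub>?A\<^esub> = \<zero>\<^bsub>?A\<^esub>" if "c \<in> carrier K" for c
    using that by (auto simp: smult_twisted_group_algebra zero_twisted_group_algebra fun_eq_iff)
  obtain x where x: "x \<in> carrier G" and "g = (x, 0) \<or> g = (x, 1)"
    using g by (auto simp: carrier_bar_group)
  then show ?thesis
  proof (elim disjE)
    assume "g = (x, 0)"
    then show ?thesis
      using x by (simp add: smult coset_components_basis_elem[of _ _ _ F] bar_sign_def
          cayley_dickson_involution_def \<sigma>e smult0 sK)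
  next
    assume "g = (x, 1)"
    then show ?thesis
      by (simp add: smult coset_components_basis_elem[of _ _ _ F] bar_sign_def
          cayley_dickson_involution_def \<sigma>0 neg smult0)
  qed
qed

theorem proposition4p1:
  fixes K :: "('k, 'r) ring_scheme" and G :: "('g, 'm) monoid_scheme"
    and F :: "'g \<Rightarrow> 'g \<Rightarrow> 'k" and \<alpha> :: 'k and s :: "'g \<Rightarrow> 'k"
  assumes "field K" and char_not_2: "\<one>\<^bsub>K\<^esub> \<oplus>\<^bsub>K\<^esub> \<one>\<^bsub>K\<^esub> \<noteq> \<zero>\<^bsub>K\<^esub>"
    and "comm_group G" and "finite (carrier G)"
    and "two_cochain K G F"
    and "\<alpha> \<in> Units K"
    and "s \<in> carrier G \<rightarrow> Units K" and "s \<one>\<^bsub>G\<^esub> = \<one>\<^bsub>K\<^esub>"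
  shows "two_cochain K (bar_group G) (bar_cochain K F s \<alpha>) \<and>
    (\<forall>\<sigma>. linear_map K (twisted_group_algebra K G F) (twisted_group_algebra K G F) \<sigma> \<and>
         (\<forall>x\<in>carrier G. \<sigma> (basis_elem K G x)
            = s x \<odot>\<^bsub>twisted_group_algebra K G F\<^esub> basis_elem K G x) \<and>
         strong_involution K (twisted_group_algebra K G F) \<sigma> \<longrightarrow>
       (\<exists>\<phi>. algebra_iso K
              (twisted_group_algebra K (bar_group G) (bar_cochain K F s \<alpha>))
              (cayley_dickson (twisted_group_algebra K G F) \<sigma> \<alpha>) \<phi> \<and>
            (\<forall>x\<in>carrier G.
               \<phi> (basis_elem K (bar_group G) (x, 0))
                 = (basis_elem K G x, \<zero>\<^bsub>twisted_group_algebra K G F\<^esub>) \<and>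
               \<phi> (basis_elem K (bar_group G) (x, 1))
                 = (\<zero>\<^bsub>twisted_group_algebra K G F\<^esub>, basis_elem K G x)) \<and>
            (\<forall>g\<in>carrier (bar_group G).
               cayley_dickson_involution (twisted_group_algebra K G F) \<sigma>
                   (\<phi> (basis_elem K (bar_group G) g))
                 = \<phi> (bar_sign K s g
                     \<odot>\<^bsub>twisted_group_algebra K (bar_group G) (bar_cochain K F s \<alpha>)\<^esub>
                       basis_elem K (bar_group G) g))))"
proof (intro conjI allI impI)
  interpret K: field K by fact
  interpret G: comm_group G by fact
  have K: "cring K" ..
  have F: "F \<in> carrier G \<rightarrow> carrier G \<rightarrow> carrier K"
    using assms(5) by (auto simp: two_cochain_def)
  have s: "s \<in> carrier G \<rightarrow> carrier K"
    using assms(7) by auto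
  have \<alpha>: "\<alpha> \<in> carrier K"
    using assms(6) by auto
  show "two_cochain K (bar_group G) (bar_cochain K F s \<alpha>)"
    using K assms(5-8) G.monoid_axioms by (rule two_cochain_bar_cochain)
  fix \<sigma>
  assume "linear_map K (twisted_group_algebra K G F) (twisted_group_algebra K G F) \<sigma> \<and>
    (\<forall>x\<in>carrier G. \<sigma> (basis_elem K G x)
       = s x \<odot>\<^bsub>twisted_group_algebra K G F\<^esub> basis_elem K G x) \<and>
    strong_involution K (twisted_group_algebra K G F) \<sigma>"
  then have \<sigma>: "\<forall>a\<in>carrier (twisted_group_algebra K G F). \<sigma> a = (\<lambda>x\<in>carrier G. s x \<otimes>\<^bsub>K\<^esub> a x)"
    using linear_map_diagonal_on_basis[OF K assms(4) s] by blast
  show "\<exists>\<phi>. algebra_iso K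
              (twisted_group_algebra K (bar_group G) (bar_cochain K F s \<alpha>))
              (cayley_dickson (twisted_group_algebra K G F) \<sigma> \<alpha>) \<phi> \<and>
            (\<forall>x\<in>carrier G.
               \<phi> (basis_elem K (bar_group G) (x, 0))
                 = (basis_elem K G x, \<zero>\<^bsub>twisted_group_algebra K G F\<^esub>) \<and>
               \<phi> (basis_elem K (bar_group G) (x, 1))
                 = (\<zero>\<^bsub>twisted_group_algebra K G F\<^esub>, basis_elem K G x)) \<and>
            (\<forall>g\<in>carrier (bar_group G).
               cayley_dickson_involution (twisted_group_algebra K G F) \<sigma>
                   (\<phi> (basis_elem K (bar_group G) g))
                 = \<phi> (bar_sign K s g
                     \<odot>\<^bsub>twisted_group_algebra K (bar_group G) (bar_cochain K F s \<alpha>)\<^esub>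
                       basis_elem K (bar_group G) g))"
    by (intro exI[of _ "coset_components G"] conjI ballI coset_components_basis_elem
        coset_components_algebra_iso[OF K assms(3,4) F \<alpha> s \<sigma>]
        cayley_dickson_involution_coset_components[OF K assms(4) s \<sigma>])
qed

end
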